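(* Let $n\ge 2$ be an integer and let $F(n)$ be the additive group of polyfunctions over $\mathbb{Z}_n$. Then $F(n)$ is isomorphic, as a group, to $$\bigoplus_{j=1}^{t(n)}(\beta_j-\beta_{j+1})\,\mathbb{Z}_{\alpha_{j+1}},$$ with the convention $\beta_{t(n)+1}:=0$ and $\alpha_{t(n)+1}:=n$.
   Context: $\mathbb{Z}_n=\mathbb{Z}/n\mathbb{Z}$. A polyfunction over $\mathbb{Z}_n$ is a function $f:\mathbb{Z}_n\to\mathbb{Z}_n$ for which there is a polynomial $p\in\mathbb{Z}_n[x]$ with $f(x)=p(x)$ for all $x\in\mathbb{Z}_n$; addition is pointwise. For a group $G$ and $r\in\mathbb{N}$, $rG$ denotes the $r$-fold direct sum $\bigoplus_{i=1}^r G$. For a positive integer $k$ let $s(k):=\min\{j\in\mathbb{N}: k\mid j!\}$ (Smarandache function). For $n\ge 2$ let $q(n)$ be the smallest prime divisor of $n$, and consider the finite set $$\{s(\gcd(n,\alpha!)) : \alpha\in\mathbb{N},\ s(\gcd(n,\alpha!))\ge q(n)\}.$$ Let $t(n)$ be its cardinality and write its elements in descending order as $s(n)=\beta_1>\beta_2>\dots>\beta_{t(n)}=q(n)$. Put $\alpha_k:=\dfrac{n}{\gcd(n,\beta_k!)}$ for $1\le k\le t(n)$. *)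

theory Defs
  imports "HOL-Algebra.Algebra" "HOL-Number_Theory.Number_Theory"
begin

text \<open>Polyfunctions are represented extensionally: a function on a ring takes the value
  \<^term>\<open>undefined\<close> outside the carrier, so that equality of functions is equality on the carrier.\<close>

definition polyfunctions :: "('a, 'b) ring_scheme \<Rightarrow> ('a \<Rightarrow> 'a) set" where
  "polyfunctions R = {f \<in> carrier R \<rightarrow>\<^sub>E carrier R.
     \<exists>p \<in> carrier (UP R). \<forall>x \<in> carrier R. f x = UnivPoly.eval R R id x p}"

definition polyfunction_group :: "('a, 'b) ring_scheme \<Rightarrow> ('a \<Rightarrow> 'a) monoid" where
  "polyfunction_group R =
     \<lparr>carrier = polyfunctions R,
      monoid.mult = (\<lambda>f g. \<lambda>x\<in>carrier R. f x \<oplus>\<^bsub>R\<^esub> g x),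
      one = (\<lambda>x\<in>carrier R. \<zero>\<^bsub>R\<^esub>)\<rparr>"

definition direct_multiple :: "nat \<Rightarrow> ('a, 'b) monoid_scheme \<Rightarrow> (nat \<Rightarrow> 'a) monoid" where
  "direct_multiple r G = sum_group {1..r} (\<lambda>_. G)"

definition smarandache :: "nat \<Rightarrow> nat" where
  "smarandache k = (LEAST j. k dvd fact j)"

definition least_prime_divisor :: "nat \<Rightarrow> nat" where
  "least_prime_divisor n = (LEAST p. Factorial_Ring.prime p \<and> p dvd n)"

definition beta_set :: "nat \<Rightarrow> nat set" where
  "beta_set n = {smarandache (gcd n (fact a)) |a.
     smarandache (gcd n (fact a)) \<ge> least_prime_divisor n}"

definition num_betas :: "nat \<Rightarrow> nat" where
  "num_betas n = card (beta_set n)"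

text \<open>Indices start at 1; \<open>beta n (num_betas n + 1) = 0\<close> and
  \<open>alpha n (num_betas n + 1) = n\<close> are the boundary conventions.\<close>

definition beta :: "nat \<Rightarrow> nat \<Rightarrow> nat" where
  "beta n j = (if 1 \<le> j \<and> j \<le> num_betas n
     then rev (sorted_list_of_set (beta_set n)) ! (j - 1) else 0)"

definition alpha :: "nat \<Rightarrow> nat \<Rightarrow> nat" where
  "alpha n j = (if 1 \<le> j \<and> j \<le> num_betas n
     then n div gcd n (fact (beta n j)) else n)"

lemma smarandache_le: "k dvd fact j \<Longrightarrow> smarandache k \<le> j"
  unfolding smarandache_def by (rule Least_le)

lemma dvd_fact_smarandache: "k > 0 \<Longrightarrow> k dvd fact (smarandache k)"
  unfolding smarandache_def by (rule LeastI[of _ k]) (auto intro: dvd_fact)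

lemma smarandache_mono: "k dvd m \<Longrightarrow> m > 0 \<Longrightarrow> smarandache k \<le> smarandache m"
  by (meson dvd_fact_smarandache dvd_trans smarandache_le)

lemma finite_beta_set:
  assumes "n > 0" shows "finite (beta_set n)"
proof (rule finite_subset)
  show "beta_set n \<subseteq> {..smarandache n}"
    using assms by (auto simp: beta_set_def intro!: smarandache_mono)
qed simp

lemma set_beta:
  assumes "n > 0" shows "beta n ` {1..num_betas n} = beta_set n"
proof -
  let ?xs = "rev (sorted_list_of_set (beta_set n))"
  have len: "length ?xs = num_betas n" by (simp add: num_betas_def)
  have "beta n ` {1..num_betas n} = (!) ?xs ` ((\<lambda>j. j - 1) ` {1..num_betas n})"
    unfolding image_image by (rule image_cong) (auto simp: beta_def)
  also have "(\<lambda>j. j - 1) ` {1..num_betas n} = {..<length ?xs}"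
  proof (intro equalityI subsetI)
    fix i assume "i \<in> {..<length ?xs}"
    then have "Suc i \<in> {1..num_betas n}" "i = Suc i - 1" using len by auto
    then show "i \<in> (\<lambda>j. j - 1) ` {1..num_betas n}" by blast
  qed (use len in auto)
  also have "(!) ?xs ` {..<length ?xs} = set ?xs"
    by (auto simp: set_conv_nth)
  also have "\<dots> = beta_set n" using finite_beta_set[OF assms] by simp
  finally show ?thesis .
qed

lemma beta_strict_decreasing:
  assumes "1 \<le> i" "i < j" "j \<le> num_betas n"
  shows "beta n j < beta n i"
proof -
  let ?ys = "sorted_list_of_set (beta_set n)"
  have len: "length ?ys = num_betas n" by (simp add: num_betas_def)
  have "?ys ! (num_betas n - j) < ?ys ! (num_betas n - i)"
    using strict_sorted_list_of_set[of "beta_set n"] assms len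
    by (intro sorted_wrt_nth_less[where P="(<)"]) auto
  then show ?thesis using assms len
    by (simp add: beta_def rev_nth)
qed

lemma (in cring) UP_eval_add:
  assumes "p \<in> carrier (UP R)" "q \<in> carrier (UP R)" "x \<in> carrier R"
  shows "UnivPoly.eval R R id x (p \<oplus>\<^bsub>UP R\<^esub> q) =
    UnivPoly.eval R R id x p \<oplus> UnivPoly.eval R R id x q"
proof -
  interpret UP_pre_univ_prop R R id "UP R" by unfold_locales simp
  show ?thesis by (rule ring_hom_add[OF eval_ring_hom[OF assms(3)] assms(1,2)])
qed

lemma (in cring) UP_eval_closed:
  assumes "p \<in> carrier (UP R)" "x \<in> carrier R"
  shows "UnivPoly.eval R R id x p \<in> carrier R"
proof -
  interpret UP_pre_univ_prop R R id "UP R" by unfold_locales simp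
  show ?thesis by (rule ring_hom_closed[OF eval_ring_hom[OF assms(2)] assms(1)])
qed

lemma polyfunctionsI:
  assumes "f \<in> extensional (carrier R)" "\<And>x. x \<in> carrier R \<Longrightarrow> f x \<in> carrier R"
    "p \<in> carrier (UP R)" "\<And>x. x \<in> carrier R \<Longrightarrow> f x = UnivPoly.eval R R id x p"
  shows "f \<in> polyfunctions R"
proof -
  have "f \<in> carrier R \<rightarrow>\<^sub>E carrier R" using assms(1,2) by (simp add: PiE_iff)
  then show ?thesis unfolding polyfunctions_def using assms(3,4) by blast
qed

lemma (in cring) comm_group_polyfunction_group: "comm_group (polyfunction_group R)"
proof -
  interpret P: cring "UP R" by (rule UP_cring.UP_cring[OF UP_cring.intro[OF cring_axioms]])
  have car: "f x \<in> carrier R" if "f \<in> polyfunctions R" "x \<in> carrier R" for f x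
    using that unfolding polyfunctions_def by blast
  have ext: "f \<in> extensional (carrier R)" if "f \<in> polyfunctions R" for f
    using that unfolding polyfunctions_def PiE_def by blast
  have closed: "(\<lambda>x\<in>carrier R. f x \<oplus> g x) \<in> polyfunctions R"
    if f: "f \<in> polyfunctions R" and g: "g \<in> polyfunctions R" for f g
  proof -
    obtain p where p: "p \<in> carrier (UP R)" "\<forall>x \<in> carrier R. f x = UnivPoly.eval R R id x p"
      using f unfolding polyfunctions_def by blast
    obtain q where q: "q \<in> carrier (UP R)" "\<forall>x \<in> carrier R. g x = UnivPoly.eval R R id x q"
      using g unfolding polyfunctions_def by blast
    show ?thesis
      by (rule polyfunctionsI[where p = "p \<oplus>\<^bsub>UP R\<^esub> q"])
        (simp_all add: p q UP_eval_closed UP_eval_add P.a_closed)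
  qed
  have eval0: "UnivPoly.eval R R id x \<zero>\<^bsub>UP R\<^esub> = \<zero>" if "x \<in> carrier R" for x
  proof -
    have "UnivPoly.eval R R id x \<zero>\<^bsub>UP R\<^esub> \<oplus> UnivPoly.eval R R id x \<zero>\<^bsub>UP R\<^esub> =
        UnivPoly.eval R R id x \<zero>\<^bsub>UP R\<^esub>"
      using UP_eval_add[OF P.zero_closed P.zero_closed that] by simp
    then show ?thesis
      using UP_eval_closed[OF P.zero_closed that] by simp
  qed
  have zero: "(\<lambda>x\<in>carrier R. \<zero>) \<in> polyfunctions R"
    by (rule polyfunctionsI[where p = "\<zero>\<^bsub>UP R\<^esub>"]) (simp_all add: eval0)
  have inv: "\<exists>g \<in> polyfunctions R. (\<lambda>x\<in>carrier R. g x \<oplus> f x) = (\<lambda>x\<in>carrier R. \<zero>)"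
    if f: "f \<in> polyfunctions R" for f
  proof -
    obtain p where p: "p \<in> carrier (UP R)" "\<forall>x \<in> carrier R. f x = UnivPoly.eval R R id x p"
      using f unfolding polyfunctions_def by blast
    define g where "g = (\<lambda>x\<in>carrier R. UnivPoly.eval R R id x (\<ominus>\<^bsub>UP R\<^esub> p))"
    have "g \<in> polyfunctions R"
      by (rule polyfunctionsI[where p = "\<ominus>\<^bsub>UP R\<^esub> p"])
        (simp_all add: g_def p UP_eval_closed)
    moreover have "g x \<oplus> f x = \<zero>" if "x \<in> carrier R" for x
      using UP_eval_add[OF P.a_inv_closed[OF p(1)] p(1) that] P.l_neg[OF p(1)]
      by (simp add: g_def p eval0 that)
    then have "(\<lambda>x\<in>carrier R. g x \<oplus> f x) = (\<lambda>x\<in>carrier R. \<zero>)" by (rule restrict_ext)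
    ultimately show ?thesis by blast
  qed
  show ?thesis
  proof (rule comm_groupI, unfold polyfunction_group_def monoid.simps partial_object.simps)
    fix f assume f: "f \<in> polyfunctions R"
    show "(\<lambda>x\<in>carrier R. (\<lambda>x\<in>carrier R. \<zero>) x \<oplus> f x) = f"
      by (rule extensionalityI[OF _ ext[OF f]]) (simp_all add: car f)
    show "\<exists>g \<in> polyfunctions R. (\<lambda>x\<in>carrier R. g x \<oplus> f x) = (\<lambda>x\<in>carrier R. \<zero>)"
      by (rule inv[OF f])
    fix g assume g: "g \<in> polyfunctions R"
    show "(\<lambda>x\<in>carrier R. f x \<oplus> g x) \<in> polyfunctions R" by (rule closed[OF f g])
    show "(\<lambda>x\<in>carrier R. f x \<oplus> g x) = (\<lambda>x\<in>carrier R. g x \<oplus> f x)"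
      by (rule restrict_ext) (simp add: car f g a_comm)
    fix h assume h: "h \<in> polyfunctions R"
    show "(\<lambda>x\<in>carrier R. (\<lambda>x\<in>carrier R. f x \<oplus> g x) x \<oplus> h x) =
        (\<lambda>x\<in>carrier R. f x \<oplus> (\<lambda>x\<in>carrier R. g x \<oplus> h x) x)"
      by (rule restrict_ext) (simp add: car f g h a_assoc)
  qed (rule zero)
qed

end

theory Submission
  imports Defs "HOL-Computational_Algebra.Polynomial"
begin

text \<open>
  A polynomial function modulo \<open>n\<close> has a Newton expansion
  \<open>x \<mapsto> \<Sum>\<^sub>k c\<^sub>k (x)\<^sub>k\<close> with integer coefficients, where
  \<open>(x)\<^sub>k = x (x - 1) \<dots> (x - k + 1) = k! (x choose k)\<close>. Since \<open>k!\<close> divides \<open>(x)\<^sub>k\<close>,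
  the terms with \<open>k \<ge> s(n)\<close> vanish modulo \<open>n\<close>. Among the remaining ones there are no hidden
  relations: \<open>(k)\<^sub>k = k!\<close> and \<open>(x)\<^sub>k = 0\<close> for \<open>x < k\<close>, so evaluating at
  \<open>x = 0, 1, \<dots>, s(n) - 1\<close> gives a triangular system, and the expansion is zero modulo \<open>n\<close> iff
  \<open>n\<close> divides every \<open>c\<^sub>k k!\<close>, that is, iff \<open>n / gcd(n, k!)\<close> divides every \<open>c\<^sub>k\<close>
  (lemmas \<open>int_poly_newton_cong\<close>, \<open>newton_coeffs_dvd\<close>, \<open>dvd_mult_fact_iff\<close>). The group of
  polyfunctions is therefore the direct sum of the cyclic groups of order \<open>n / gcd(n, k!)\<close> for
  \<open>k < s(n)\<close> (theorem \<open>polyfunction_group_iso_factorial_sum\<close>).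

  It remains to collect equal summands. The numbers \<open>\<beta>\<^sub>j\<close> are the places where \<open>gcd(n, k!)\<close>
  jumps as \<open>k\<close> grows: on \<open>\<beta>\<^sub>j\<^sub>+\<^sub>1 \<le> k < \<beta>\<^sub>j\<close> the order is constantly \<open>\<alpha>\<^sub>j\<^sub>+\<^sub>1\<close>
  (lemma \<open>div_gcd_fact_eq_alpha\<close>). Since \<open>\<beta>\<^sub>1 = s(n)\<close> and \<open>\<beta>\<^sub>t\<^sub>+\<^sub>1 = 0\<close> for \<open>t = t(n)\<close>, these blocks
  partition \<open>{..<s(n)}\<close>, and regrouping the sum along them
  (lemmas \<open>bij_betw_consecutive_blocks\<close> and \<open>sum_group_regroup\<close>) gives the claimed form.
\<close>

section \<open>Regrouping direct sums\<close>

text \<open>A direct sum may be computed in stages. The map reads a family over \<open>K\<close> through the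
  enumeration \<open>h\<close> as a doubly indexed family; the only point that is not pure reindexing is
  that finite support over \<open>K\<close> corresponds to finitely many nonzero rows, each of finite support.
  The groups in the blocks are a separate family \<open>H\<close>, so that they may be written by a formula
  that agrees with \<open>G\<close> only on the index sets.\<close>

lemma sum_group_regroup:
  assumes h: "bij_betw (\<lambda>(i, j). h i j) (Sigma I J) K"
    and G: "\<And>k. k \<in> K \<Longrightarrow> group (G k)"
    and H: "\<And>i j. i \<in> I \<Longrightarrow> j \<in> J i \<Longrightarrow> H i j = G (h i j)"
  shows "sum_group K G \<cong> sum_group I (\<lambda>i. sum_group (J i) (H i))"
proof -
  define g where "g = inv_into (Sigma I J) (\<lambda>(i, j). h i j)"
  have hK: "h i j \<in> K" if "i \<in> I" "j \<in> J i" for i j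
    using h that by (auto simp: bij_betw_def)
  have gh: "g (h i j) = (i, j)" if "i \<in> I" "j \<in> J i" for i j
    using bij_betw_inv_into_left[OF h, of "(i, j)"] that by (simp add: g_def)
  have gK: "fst (g k) \<in> I" "snd (g k) \<in> J (fst (g k))" "h (fst (g k)) (snd (g k)) = k"
    if "k \<in> K" for k
  proof -
    have "k \<in> (\<lambda>(i, j). h i j) ` Sigma I J" using h that by (simp add: bij_betw_def)
    then obtain i j where "i \<in> I" "j \<in> J i" "k = h i j" by auto
    then show "fst (g k) \<in> I" "snd (g k) \<in> J (fst (g k))" "h (fst (g k)) (snd (g k)) = k"
      using gh by auto
  qed
  have grpH: "group (H i j)" if "i \<in> I" "j \<in> J i" for i j
    using that H G hK by simp
  have inner: "carrier (sum_group (J i) (H i)) =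
      {x \<in> \<Pi>\<^sub>E j\<in>J i. carrier (H i j). finite {j \<in> J i. x j \<noteq> \<one>\<^bsub>H i j\<^esub>}}" if "i \<in> I" for i
    using that by (intro carrier_sum_group grpH)
  have outer: "carrier (sum_group I (\<lambda>i. sum_group (J i) (H i))) =
      {y \<in> \<Pi>\<^sub>E i\<in>I. carrier (sum_group (J i) (H i)).
         finite {i \<in> I. y i \<noteq> (\<lambda>j\<in>J i. \<one>\<^bsub>H i j\<^esub>)}}"
    by (subst carrier_sum_group) (auto intro!: sum_group grpH)
  have flat: "carrier (sum_group K G) =
      {x \<in> \<Pi>\<^sub>E k\<in>K. carrier (G k). finite {k \<in> K. x k \<noteq> \<one>\<^bsub>G k\<^esub>}}"
    by (intro carrier_sum_group G)
  define \<phi> where "\<phi> x = (\<lambda>i\<in>I. \<lambda>j\<in>J i. x (h i j))" for x :: "'c \<Rightarrow> 'd"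
  have "\<phi> \<in> iso (sum_group K G) (sum_group I (\<lambda>i. sum_group (J i) (H i)))"
  proof (rule isoI)
    show "\<phi> \<in> hom (sum_group K G) (sum_group I (\<lambda>i. sum_group (J i) (H i)))"
    proof (rule homI)
      fix x assume x: "x \<in> carrier (sum_group K G)"
      \<comment> \<open>The support of \<open>x\<close> in double indices: its projections bound the supports of the
        rows and the set of nonzero rows.\<close>
      define T where "T = g ` {k \<in> K. x k \<noteq> \<one>\<^bsub>G k\<^esub>}"
      have T: "finite T" using x unfolding flat T_def by blast
      have inT: "(i, j) \<in> T" if "i \<in> I" "j \<in> J i" "x (h i j) \<noteq> \<one>\<^bsub>H i j\<^esub>" for i j
        using that gh H hK unfolding T_def by (auto intro!: image_eqI[where x = "h i j"])
      have "(\<lambda>j\<in>J i. x (h i j)) \<in> carrier (sum_group (J i) (H i))" if i: "i \<in> I" for i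
      proof -
        have "{j \<in> J i. (\<lambda>j\<in>J i. x (h i j)) j \<noteq> \<one>\<^bsub>H i j\<^esub>} \<subseteq> snd ` T"
          using inT i by force
        then have "finite {j \<in> J i. (\<lambda>j\<in>J i. x (h i j)) j \<noteq> \<one>\<^bsub>H i j\<^esub>}"
          using T finite_surj by blast
        moreover have "x (h i j) \<in> carrier (H i j)" if "j \<in> J i" for j
          using x i that hK H by (auto simp: flat)
        ultimately show ?thesis by (simp add: inner i)
      qed
      moreover have "finite {i \<in> I. \<phi> x i \<noteq> (\<lambda>j\<in>J i. \<one>\<^bsub>H i j\<^esub>)}"
      proof (rule finite_subset)
        show "{i \<in> I. \<phi> x i \<noteq> (\<lambda>j\<in>J i. \<one>\<^bsub>H i j\<^esub>)} \<subseteq> fst ` T"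
        proof
          fix i assume i: "i \<in> {i \<in> I. \<phi> x i \<noteq> (\<lambda>j\<in>J i. \<one>\<^bsub>H i j\<^esub>)}"
          then have "\<exists>j\<in>J i. x (h i j) \<noteq> \<one>\<^bsub>H i j\<^esub>"
            by (auto simp: \<phi>_def intro: restrict_ext)
          then show "i \<in> fst ` T" using inT i by force
        qed
      qed (use T in simp)
      ultimately show "\<phi> x \<in> carrier (sum_group I (\<lambda>i. sum_group (J i) (H i)))"
        by (simp add: outer \<phi>_def)
    next
      fix x y
      show "\<phi> (x \<otimes>\<^bsub>sum_group K G\<^esub> y) = \<phi> x \<otimes>\<^bsub>sum_group I (\<lambda>i. sum_group (J i) (H i))\<^esub> \<phi> y"
        by (auto simp: \<phi>_def H hK intro!: restrict_ext)
    qed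
    show "bij_betw \<phi> (carrier (sum_group K G)) (carrier (sum_group I (\<lambda>i. sum_group (J i) (H i))))"
    proof (rule bij_betw_imageI)
      show "inj_on \<phi> (carrier (sum_group K G))"
      proof (rule inj_onI)
        fix x y assume x: "x \<in> carrier (sum_group K G)" and y: "y \<in> carrier (sum_group K G)"
          and eq: "\<phi> x = \<phi> y"
        show "x = y"
        proof (rule extensionalityI[of _ K])
          show "x \<in> extensional K" "y \<in> extensional K" using x y by (auto simp: flat PiE_def)
          fix k assume "k \<in> K"
          then show "x k = y k"
            using fun_cong[OF fun_cong[OF eq, of "fst (g k)"], of "snd (g k)"] gK[of k]
            by (simp add: \<phi>_def)
        qed
      qed
      show "\<phi> ` carrier (sum_group K G) = carrier (sum_group I (\<lambda>i. sum_group (J i) (H i)))"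
      proof
        show "\<phi> ` carrier (sum_group K G) \<subseteq> carrier (sum_group I (\<lambda>i. sum_group (J i) (H i)))"
          using \<open>\<phi> \<in> hom _ _\<close> by (auto simp: hom_def)
        show "carrier (sum_group I (\<lambda>i. sum_group (J i) (H i))) \<subseteq> \<phi> ` carrier (sum_group K G)"
        proof
          fix y assume y: "y \<in> carrier (sum_group I (\<lambda>i. sum_group (J i) (H i)))"
          have yi: "y i \<in> carrier (sum_group (J i) (H i))" if "i \<in> I" for i
            using y that by (auto simp: outer)
          define x where "x = (\<lambda>k\<in>K. y (fst (g k)) (snd (g k)))"
          define S where "S = (SIGMA i:{i \<in> I. y i \<noteq> (\<lambda>j\<in>J i. \<one>\<^bsub>H i j\<^esub>)}. {j \<in> J i. y i j \<noteq> \<one>\<^bsub>H i j\<^esub>})"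
          have "finite S"
            unfolding S_def
          proof (rule finite_SigmaI)
            show "finite {i \<in> I. y i \<noteq> (\<lambda>j\<in>J i. \<one>\<^bsub>H i j\<^esub>)}" using y by (simp add: outer)
          qed (use yi inner in auto)
          moreover have "{k \<in> K. x k \<noteq> \<one>\<^bsub>G k\<^esub>} \<subseteq> (\<lambda>(i, j). h i j) ` S"
          proof
            fix k assume k: "k \<in> {k \<in> K. x k \<noteq> \<one>\<^bsub>G k\<^esub>}"
            then have "y (fst (g k)) (snd (g k)) \<noteq> \<one>\<^bsub>H (fst (g k)) (snd (g k))\<^esub>"
              using gK[of k] H by (auto simp: x_def)
            then have "(fst (g k), snd (g k)) \<in> S"
              using gK[of k] k unfolding S_def by fastforce
            then have "g k \<in> S" by simp
            then show "k \<in> (\<lambda>(i, j). h i j) ` S"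
              using gK(3)[of k] k by (auto simp: split_beta intro!: image_eqI[where x = "g k"])
          qed
          ultimately have "finite {k \<in> K. x k \<noteq> \<one>\<^bsub>G k\<^esub>}"
            by (rule finite_surj)
          moreover have "x k \<in> carrier (G k)" if k: "k \<in> K" for k
          proof -
            have "y (fst (g k)) (snd (g k)) \<in> carrier (H (fst (g k)) (snd (g k)))"
              using yi[OF gK(1)[OF k]] gK[OF k] by (auto simp: inner)
            then show ?thesis using H gK[OF k] k by (simp add: x_def)
          qed
          ultimately have "x \<in> carrier (sum_group K G)" by (simp add: flat x_def)
          moreover have "\<phi> x = y"
          proof (rule extensionalityI[of _ I])
            show "\<phi> x \<in> extensional I" by (simp add: \<phi>_def)
            show "y \<in> extensional I" using y by (auto simp: outer PiE_def)
            fix i assume i: "i \<in> I"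
            have "y i \<in> extensional (J i)" using yi[OF i] by (auto simp: inner i PiE_def)
            then show "\<phi> x i = y i"
              by (intro extensionalityI[of _ "J i"]) (auto simp: \<phi>_def x_def i hK gh)
          qed
          ultimately show "y \<in> \<phi> ` carrier (sum_group K G)" by blast
        qed
      qed
    qed
  qed
  then show ?thesis by (rule is_isoI)
qed

lemma bij_betw_consecutive_blocks:
  fixes b :: "nat \<Rightarrow> nat"
  assumes anti: "\<And>i j. 1 \<le> i \<Longrightarrow> i \<le> j \<Longrightarrow> j \<le> t + 1 \<Longrightarrow> b j \<le> b i"
    and end0: "b (t + 1) = 0"
  shows "bij_betw (\<lambda>(j, i). b (j + 1) + i - 1) (SIGMA j:{1..t}. {1..b j - b (j + 1)}) {..<b 1}"
proof (rule bij_betw_imageI)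
  let ?h = "\<lambda>(j, i). b (j + 1) + i - 1" and ?D = "SIGMA j:{1..t}. {1..b j - b (j + 1)}"
  have block: "b (j + 1) \<le> ?h (j, i)" "?h (j, i) < b j" if "(j, i) \<in> ?D" for j i
    using that by auto
  have less: "?h (j', i') < ?h (j, i)" if "j < j'" "(j, i) \<in> ?D" "(j', i') \<in> ?D" for j i j' i'
  proof -
    have "b j' \<le> b (j + 1)" using that by (intro anti) auto
    then show ?thesis using block[of j i] block[of j' i'] that by linarith
  qed
  show "inj_on ?h ?D"
  proof (rule inj_onI)
    fix p q assume p: "p \<in> ?D" and q: "q \<in> ?D" and eq: "?h p = ?h q"
    obtain j i j' i' where pq: "p = (j, i)" "q = (j', i')" by (metis surj_pair)
    have "j = j'"
      using less[of j j' i i'] less[of j' j i' i] p q eq pq by (metis less_irrefl nat_neq_iff)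
    then show "p = q" using eq p q pq by auto
  qed
  show "?h ` ?D = {..<b 1}"
  proof
    show "?h ` ?D \<subseteq> {..<b 1}"
    proof clarify
      fix j i assume ji: "j \<in> {1..t}" "i \<in> {1..b j - b (j + 1)}"
      then have "b j \<le> b 1" by (intro anti) auto
      then show "b (j + 1) + i - 1 < b 1" using block[of j i] ji by auto
    qed
    show "{..<b 1} \<subseteq> ?h ` ?D"
    proof
      fix k assume k: "k \<in> {..<b 1}"
      \<comment> \<open>The block containing \<open>k\<close> is the first whose lower end is at most \<open>k\<close>.\<close>
      define j where "j = (LEAST j. b (j + 1) \<le> k)"
      have j1: "b (j + 1) \<le> k" unfolding j_def by (rule LeastI[of _ t]) (use end0 in simp)
      have jt: "j \<le> t" unfolding j_def by (rule Least_le) (use end0 in simp)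
      have j0: "j \<noteq> 0" using j1 k by (intro notI) simp
      have "\<not> b ((j - 1) + 1) \<le> k"
        by (rule not_less_Least[where P = "\<lambda>j. b (j + 1) \<le> k"], fold j_def) (use j0 in simp)
      then have j2: "k < b j" using j0 by simp
      have "(j, k - b (j + 1) + 1) \<in> ?D" using j0 jt j1 j2 by auto
      moreover have "?h (j, k - b (j + 1) + 1) = k" using j1 by simp
      ultimately show "k \<in> ?h ` ?D" by (metis (no_types, lifting) image_eqI)
    qed
  qed
qed

section \<open>Polyfunctions modulo m and integer polynomials\<close>

lemma (in residues) finsum_eq_sum_mod:
  assumes "finite A" "f \<in> A \<rightarrow> carrier R"
  shows "finsum R f A = (\<Sum>i\<in>A. f i) mod m"
  using assms
proof (induction rule: finite_induct)
  case empty
  then show ?case using m_gt_one by (simp add: res_zero_eq)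
next
  case (insert a A)
  then show ?case by (simp add: res_add_eq mod_add_right_eq)
qed

lemma (in residues) eval_eq_sum_mod:
  assumes p: "p \<in> carrier (UP R)" and x: "x \<in> carrier R"
  shows "UnivPoly.eval R R id x p = (\<Sum>i\<le>deg R p. p i * x ^ i) mod m"
proof -
  have pc: "p i \<in> carrier R" for i using p by (auto simp: UP_def up_def)
  have co: "up_ring.coeff (UP R) p i = p i" for i using p by (simp add: UP_def)
  have pw: "x [^] i = x ^ i mod m" for i
    using pow_cong[of x i] x by (simp add: res_carrier_eq)
  interpret UP_cring R "UP R" by (simp add: UP_cring_def cring)
  have "UnivPoly.eval R R id x p = (\<Oplus>i\<in>{..deg R p}. p i \<otimes> x [^] i)"
    using p by (simp add: eval_on_carrier co)
  also have "\<dots> = (\<Sum>i\<le>deg R p. p i \<otimes> x [^] i) mod m"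
    using pc x by (intro finsum_eq_sum_mod) auto
  also have "\<dots> = (\<Sum>i\<le>deg R p. p i * x ^ i) mod m"
    by (simp add: res_mult_eq pw mod_mult_right_eq mod_sum_eq)
  finally show ?thesis .
qed

text \<open>Polynomials over the residue ring have reduced coefficients, whereas falling factorials are
  naturally integer polynomials. Reducing integer coefficients modulo \<open>m\<close>, and reading reduced ones
  as integers, shows that both kinds of polynomial induce the same functions.\<close>

lemma (in residues) polyfunctions_iff_int_poly:
  "f \<in> polyfunctions R \<longleftrightarrow>
    f \<in> extensional (carrier R) \<and> (\<exists>P::int poly. \<forall>x\<in>carrier R. f x = poly P x mod m)"
proof (intro iffI conjI)
  interpret UP_cring R "UP R" by (simp add: UP_cring_def cring)
  {
    assume f: "f \<in> polyfunctions R"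
    then show "f \<in> extensional (carrier R)" by (auto simp: polyfunctions_def PiE_def)
    obtain p where p: "p \<in> carrier (UP R)" "\<forall>x\<in>carrier R. f x = UnivPoly.eval R R id x p"
      using f by (auto simp: polyfunctions_def)
    have "f x = poly (\<Sum>i\<le>deg R p. Polynomial.monom (p i) i) x mod m" if "x \<in> carrier R" for x
      using p that by (simp add: eval_eq_sum_mod poly_sum poly_monom)
    then show "\<exists>P::int poly. \<forall>x\<in>carrier R. f x = poly P x mod m" by blast
  next
    assume "f \<in> extensional (carrier R) \<and> (\<exists>P::int poly. \<forall>x\<in>carrier R. f x = poly P x mod m)"
    then obtain P :: "int poly" where ext: "f \<in> extensional (carrier R)"
      and P: "\<And>x. x \<in> carrier R \<Longrightarrow> f x = poly P x mod m" by blast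
    define p where "p = (\<lambda>i. Polynomial.coeff P i mod m)"
    have p: "p \<in> carrier (UP R)"
      using m_gt_one
      by (auto simp: p_def UP_def up_def res_carrier_eq res_zero_eq bound_def coeff_eq_0
          intro!: exI[of _ "degree P"])
    have above: "p i = 0" if "i > deg R p" for i
      using deg_aboveD[OF that p] p by (simp add: UP_def res_zero_eq)
    \<comment> \<open>Reduction may lower the degree, so both evaluations are padded to a common length.\<close>
    define N where "N = max (deg R p) (degree P)"
    have "f x = UnivPoly.eval R R id x p" if x: "x \<in> carrier R" for x
    proof -
      have "poly P x = (\<Sum>i\<le>N. Polynomial.coeff P i * x ^ i)"
        unfolding poly_altdef
        by (rule sum.mono_neutral_left) (auto simp: N_def coeff_eq_0)
      also have "\<dots> mod m = (\<Sum>i\<le>N. p i * x ^ i) mod m"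
        unfolding p_def by (subst (1 2) mod_sum_eq [symmetric]) (simp add: mod_mult_left_eq)
      also have "(\<Sum>i\<le>N. p i * x ^ i) = (\<Sum>i\<le>deg R p. p i * x ^ i)"
        by (rule sum.mono_neutral_right) (auto simp: N_def above)
      finally show ?thesis using p x by (simp add: eval_eq_sum_mod P)
    qed
    moreover have "f x \<in> carrier R" if "x \<in> carrier R" for x
      using P[OF that] m_gt_one by (simp add: res_carrier_eq)
    ultimately show "f \<in> polyfunctions R" using ext p by (intro polyfunctionsI)
  }
qed

section \<open>Newton expansions\<close>

text \<open>The falling factorial \<open>x (x - 1) \<dots> (x - k + 1)\<close>, written so that its divisibility by \<open>k!\<close>
  and its vanishing for \<open>x < k\<close> are immediate.\<close>

definition falling_fact :: "nat \<Rightarrow> nat \<Rightarrow> int" where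
  "falling_fact x k = int (fact k * (x choose k))"

lemma falling_fact_0 [simp]: "falling_fact x 0 = 1"
  by (simp add: falling_fact_def)

lemma falling_fact_eq_0: "x < k \<Longrightarrow> falling_fact x k = 0"
  by (simp add: falling_fact_def)

lemma falling_fact_self: "falling_fact k k = fact k"
  by (simp add: falling_fact_def)

lemma fact_dvd_falling_fact: "fact k dvd falling_fact x k"
  by (simp add: falling_fact_def)

lemma falling_fact_Suc: "falling_fact x (Suc k) = (int x - int k) * falling_fact x k"
proof (cases "k \<le> x")
  case True
  have "Suc k * (x choose Suc k) = (x - k) * (x choose k)"
    by (simp only: binomial_absorption binomial_absorb_comp)
  then have "fact k * (Suc k * (x choose Suc k)) = fact k * ((x - k) * (x choose k))"
    by (rule arg_cong)
  then have "fact (Suc k) * (x choose Suc k) = (x - k) * (fact k * (x choose k))"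
    by (simp only: fact_Suc of_nat_id mult_ac)
  then have "falling_fact x (Suc k) = int (x - k) * falling_fact x k"
    unfolding falling_fact_def by (metis of_nat_mult)
  then show ?thesis using True by (simp add: of_nat_diff)
qed (simp add: falling_fact_eq_0)

lemma falling_fact_poly: "poly (\<Prod>i<k. [:- int i, 1:]) (int x) = falling_fact x k"
  by (induction k) (simp_all add: falling_fact_Suc algebra_simps)

text \<open>Horner's scheme: the rule \<open>x (x)\<^sub>k = (x)\<^sub>k\<^sub>+\<^sub>1 + k (x)\<^sub>k\<close> turns an expansion of \<open>P\<close> into one
  of \<open>a + x P\<close>. The single new term of index \<open>S\<close> that this produces is a multiple of \<open>S!\<close>, hence
  of \<open>n\<close>, so the length of the expansion stays \<open>S\<close> for all degrees.\<close>

lemma int_poly_newton_cong: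
  fixes P :: "int poly"
  assumes n: "n dvd fact S"
  shows "\<exists>c. \<forall>x. [poly P (int x) = (\<Sum>k<S. c k * falling_fact x k)] (mod int n)"
proof (induction P)
  case 0
  show ?case by (rule exI[of _ "\<lambda>_. 0"]) simp
next
  case (pCons a P)
  then obtain c where c: "\<And>x. [poly P (int x) = (\<Sum>k<S. c k * falling_fact x k)] (mod int n)"
    by blast
  define d where "d k = (case k of 0 \<Rightarrow> a | Suc l \<Rightarrow> c l)" for k
  have "[poly (pCons a P) (int x) = (\<Sum>k<S. (d k + int k * c k) * falling_fact x k)] (mod int n)"
    for x
  proof -
    have "[poly (pCons a P) (int x) = a + int x * (\<Sum>k<S. c k * falling_fact x k)] (mod int n)"
      unfolding poly_pCons by (intro cong_add cong_mult cong_refl c)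
    also have "a + int x * (\<Sum>k<S. c k * falling_fact x k) =
        (a + (\<Sum>k<S. c k * falling_fact x (Suc k))) + (\<Sum>k<S. int k * c k * falling_fact x k)"
      by (simp add: falling_fact_Suc sum_distrib_left algebra_simps flip: sum.distrib)
    also have "a + (\<Sum>k<S. c k * falling_fact x (Suc k)) = (\<Sum>k<Suc S. d k * falling_fact x k)"
      by (simp add: sum.lessThan_Suc_shift d_def del: sum.lessThan_Suc)
    also have "[\<dots> + (\<Sum>k<S. int k * c k * falling_fact x k) =
        ((\<Sum>k<S. d k * falling_fact x k) + 0) + (\<Sum>k<S. int k * c k * falling_fact x k)] (mod int n)"
    proof -
      have "int n dvd fact S" using n by (metis of_nat_dvd_iff of_nat_fact)
      then have "int n dvd d S * falling_fact x S"
        using fact_dvd_falling_fact[of S x] by (meson dvd_mult dvd_trans)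
      then have "[d S * falling_fact x S = 0] (mod int n)" by (simp add: cong_0_iff)
      then show ?thesis unfolding sum.lessThan_Suc by (intro cong_add cong_refl)
    qed
    finally show ?thesis by (simp add: sum.distrib algebra_simps)
  qed
  then show ?case by (intro exI allI)
qed

text \<open>The values \<open>(x)\<^sub>k\<close> form a triangular matrix with diagonal \<open>k!\<close>: at \<open>x = k\<close> the terms above
  index \<open>k\<close> vanish, and those below are multiples of \<open>n\<close> by induction.\<close>

lemma newton_coeffs_dvd:
  fixes c :: "nat \<Rightarrow> int"
  assumes zero: "\<And>x. x < S \<Longrightarrow> int n dvd (\<Sum>k<S. c k * falling_fact x k)"
    and k: "k < S"
  shows "int n dvd c k * fact k"
  using k
proof (induction k rule: less_induct)
  case (less k)
  have "(\<Sum>j<S. c j * falling_fact k j) = (\<Sum>j<Suc k. c j * falling_fact k j)"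
    using less.prems by (intro sum.mono_neutral_right) (auto simp: falling_fact_eq_0)
  also have "\<dots> = (\<Sum>j<k. c j * falling_fact k j) + c k * fact k"
    by (simp add: falling_fact_self)
  finally have "int n dvd (\<Sum>j<k. c j * falling_fact k j) + c k * fact k"
    using zero[OF less.prems] by simp
  moreover have "int n dvd (\<Sum>j<k. c j * falling_fact k j)"
  proof (rule dvd_sum)
    fix j assume "j \<in> {..<k}"
    then have "int n dvd c j * fact j" using less by simp
    then show "int n dvd c j * falling_fact k j"
      using fact_dvd_falling_fact[of j k] by (meson dvd_refl dvd_trans mult_dvd_mono)
  qed
  ultimately show ?case using dvd_add_right_iff by blast
qed

text \<open>Identifies the annihilator of the \<open>k\<close>-th Newton basis function, and thereby the order of
  the cyclic summand it spans.\<close>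

lemma dvd_mult_fact_iff:
  fixes c :: int
  assumes "n > 0"
  shows "int n dvd c * fact k \<longleftrightarrow> int (n div gcd n (fact k)) dvd c"
proof -
  define g where "g = gcd n (fact k)"
  have g: "g > 0" "n = n div g * g" "fact k = fact k div g * g"
    using assms by (auto simp: g_def)
  have cop: "coprime (int (n div g)) (int (fact k div g))"
    using assms unfolding g_def coprime_int_iff by (intro div_gcd_coprime) simp
  have "int n dvd c * fact k \<longleftrightarrow> int (n div g) * int g dvd (c * int (fact k div g)) * int g"
    using g by (metis mult.assoc of_nat_fact of_nat_mult)
  also have "\<dots> \<longleftrightarrow> int (n div g) dvd c * int (fact k div g)"
    using g(1) by simp
  also have "\<dots> \<longleftrightarrow> int (n div g) dvd c"
    using cop by (simp add: coprime_dvd_mult_left_iff)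
  finally show ?thesis by (simp add: g_def)
qed

section \<open>The factorial decomposition of the group of polyfunctions\<close>

text \<open>The isomorphism, from right to left, sends a coefficient family to its Newton expansion.
  The bound \<open>S \<le> n\<close> ensures that the points \<open>0, \<dots>, S - 1\<close>, at which the coefficients are
  recovered, are distinct residues. The choice of \<open>S\<close> does not affect the group, because
  \<open>n / gcd(n, k!) = 1\<close> as soon as \<open>n\<close> divides \<open>k!\<close>.\<close>

theorem polyfunction_group_iso_factorial_sum:
  assumes n: "n \<ge> 2" and S: "n dvd fact S" "S \<le> n"
  shows "polyfunction_group (residue_ring (int n)) \<cong>
    sum_group {..<S} (\<lambda>k. integer_mod_group (n div gcd n (fact k)))"
proof -
  let ?R = "residue_ring (int n)"
  interpret residues "int n" ?R
    using n by (simp add: residues_def)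
  let ?F = "polyfunction_group ?R"
  define a where "a k = n div gcd n (fact k)" for k
  have a: "a k > 0" for k using n by (simp add: a_def div_greater_zero_iff gcd_le1_nat)
  let ?G = "sum_group {..<S} (\<lambda>k. integer_mod_group (a k))"
  have carG: "carrier ?G = (\<Pi>\<^sub>E k\<in>{..<S}. {0..<int (a k)})"
  proof -
    have "carrier (integer_mod_group (a k)) = {0..<int (a k)}" for k
      using a[of k] by (simp add: carrier_integer_mod_group)
    then show ?thesis by (subst carrier_sum_group) auto
  qed
  have carF: "carrier ?F = polyfunctions ?R" by (simp add: polyfunction_group_def)
  have a_falling: "int n dvd c * falling_fact x k" if "int (a k) dvd c" for c x k
  proof -
    have "int n dvd c * fact k" using that n by (simp add: dvd_mult_fact_iff a_def)
    then show ?thesis using fact_dvd_falling_fact[of k x] by (meson dvd_refl dvd_trans mult_dvd_mono)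
  qed
  \<comment> \<open>Coefficients matter only modulo \<open>a k\<close>: this makes the expansion compatible with the
    reduced addition in the summands, and lets surjectivity use reduced coefficients.\<close>
  have sum_cong: "[(\<Sum>k<S. c k * falling_fact x k) = (\<Sum>k<S. d k * falling_fact x k)] (mod int n)"
    if "\<And>k. k < S \<Longrightarrow> [c k = d k] (mod int (a k))" for c d x
  proof (rule cong_sum)
    fix k assume "k \<in> {..<S}"
    then have "int (a k) dvd c k - d k" using that by (simp add: cong_iff_dvd_diff)
    then show "[c k * falling_fact x k = d k * falling_fact x k] (mod int n)"
      using a_falling by (simp add: cong_iff_dvd_diff flip: left_diff_distrib)
  qed
  define \<Phi> where "\<Phi> c = (\<lambda>x\<in>carrier ?R. (\<Sum>k<S. c k * falling_fact (nat x) k) mod int n)" for c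
  have "\<Phi> \<in> iso ?G ?F"
  proof (rule isoI)
    show hom: "\<Phi> \<in> hom ?G ?F"
    proof (rule homI)
      fix c
      let ?P = "\<Sum>k<S. smult (c k) (\<Prod>i<k. [:- int i, 1:])"
      have "\<Phi> c x = poly ?P x mod int n" if "x \<in> carrier ?R" for x
        using that falling_fact_poly[of _ "nat x"]
        by (simp add: \<Phi>_def poly_sum res_carrier_eq)
      then show "\<Phi> c \<in> carrier ?F"
        unfolding carF polyfunctions_iff_int_poly by (auto simp: \<Phi>_def)
    next
      fix c d
      have "[(\<Sum>k<S. (c k + d k) mod int (a k) * falling_fact x k) =
          (\<Sum>k<S. (c k + d k) * falling_fact x k)] (mod int n)" for x
        by (rule sum_cong) (simp add: cong_def)
      then have "(\<Sum>k<S. (c k + d k) mod int (a k) * falling_fact x k) mod int n =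
          ((\<Sum>k<S. c k * falling_fact x k) mod int n +
           (\<Sum>k<S. d k * falling_fact x k) mod int n) mod int n" for x
        by (simp add: cong_def mod_add_eq distrib_right sum.distrib)
      then show "\<Phi> (c \<otimes>\<^bsub>?G\<^esub> d) = \<Phi> c \<otimes>\<^bsub>?F\<^esub> \<Phi> d"
        by (auto simp: \<Phi>_def polyfunction_group_def res_add_eq intro!: restrict_ext)
    qed
    show "bij_betw \<Phi> (carrier ?G) (carrier ?F)"
    proof (rule bij_betw_imageI)
      show "inj_on \<Phi> (carrier ?G)"
      proof (rule inj_onI)
        fix c d assume c: "c \<in> carrier ?G" and d: "d \<in> carrier ?G" and eq: "\<Phi> c = \<Phi> d"
        show "c = d"
        proof (rule extensionalityI[of _ "{..<S}"])
          show "c \<in> extensional {..<S}" "d \<in> extensional {..<S}"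
            using c d by (auto simp: carG PiE_def)
          fix k assume k: "k \<in> {..<S}"
          have "int n dvd (\<Sum>k<S. (c k - d k) * falling_fact x k)" if "x < S" for x
          proof -
            have "int x \<in> carrier ?R" using that S(2) by (simp add: res_carrier_eq)
            then have "[(\<Sum>k<S. c k * falling_fact x k) = (\<Sum>k<S. d k * falling_fact x k)] (mod int n)"
              using fun_cong[OF eq, of "int x"] by (simp add: \<Phi>_def cong_def)
            then show ?thesis
              by (simp add: cong_iff_dvd_diff left_diff_distrib sum_subtractf)
          qed
          then have "int n dvd (c k - d k) * fact k"
            using k by (intro newton_coeffs_dvd) auto
          then have "[c k = d k] (mod int (a k))"
            using n by (simp add: dvd_mult_fact_iff a_def cong_iff_dvd_diff)
          moreover have "c k \<in> {0..<int (a k)}" "d k \<in> {0..<int (a k)}"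
            using c d k unfolding carG by blast+
          ultimately show "c k = d k" by (simp add: cong_def)
        qed
      qed
      show "\<Phi> ` carrier ?G = carrier ?F"
      proof
        show "\<Phi> ` carrier ?G \<subseteq> carrier ?F" using hom by (auto simp: hom_def)
        show "carrier ?F \<subseteq> \<Phi> ` carrier ?G"
        proof
          fix f assume "f \<in> carrier ?F"
          then obtain P :: "int poly" where ext: "f \<in> extensional (carrier ?R)"
            and P: "\<And>x. x \<in> carrier ?R \<Longrightarrow> f x = poly P x mod int n"
            unfolding carF polyfunctions_iff_int_poly by blast
          obtain c where c: "\<And>x. [poly P (int x) = (\<Sum>k<S. c k * falling_fact x k)] (mod int n)"
            using int_poly_newton_cong[OF S(1)] by blast
          define d where "d = (\<lambda>k\<in>{..<S}. c k mod int (a k))"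
          have "d \<in> carrier ?G" using a by (auto simp: carG d_def)
          moreover have "\<Phi> d = f"
          proof (rule extensionalityI[of _ "carrier ?R"])
            show "\<Phi> d \<in> extensional (carrier ?R)" by (simp add: \<Phi>_def)
            fix x assume x: "x \<in> carrier ?R"
            have "[poly P (int (nat x)) = (\<Sum>k<S. d k * falling_fact (nat x) k)] (mod int n)"
              using c by (rule cong_trans) (rule sum_cong, simp add: cong_def d_def)
            then show "\<Phi> d x = f x"
              using x P[OF x] by (simp add: \<Phi>_def cong_def res_carrier_eq)
          qed (rule ext)
          ultimately show "f \<in> \<Phi> ` carrier ?G" by blast
        qed
      qed
    qed
  qed
  then have "?G \<cong> ?F" by (rule is_isoI)
  moreover have "group ?G" by simp
  ultimately show ?thesis unfolding a_def using group.iso_sym by blast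
qed

section \<open>The jumps of \<open>gcd(n, k!)\<close>\<close>

lemma least_prime_divisor_props:
  assumes "n \<ge> 2"
  shows "Factorial_Ring.prime (least_prime_divisor n)" "least_prime_divisor n dvd n"
proof -
  obtain p where "Factorial_Ring.prime p \<and> p dvd n"
    using assms prime_factor_nat[of n] by auto
  then have "Factorial_Ring.prime (least_prime_divisor n) \<and> least_prime_divisor n dvd n"
    unfolding least_prime_divisor_def by (rule LeastI)
  then show "Factorial_Ring.prime (least_prime_divisor n)" "least_prime_divisor n dvd n" by auto
qed

lemma smarandache_le_self: "k > 0 \<Longrightarrow> smarandache k \<le> k"
  by (rule smarandache_le) (auto intro: dvd_fact)

text \<open>Why the values of \<open>s\<close> below the least prime divisor are left out of the set of the \<open>\<beta>\<^sub>j\<close>: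
  a divisor \<open>g \<noteq> 1\<close> has a prime factor, which must occur in \<open>s(g)!\<close>, so only \<open>g = 1\<close> attains such
  a value.\<close>

lemma dvd_eq_1_if_smarandache_less:
  assumes n: "n \<ge> 2" and g: "g dvd n" and less: "smarandache g < least_prime_divisor n"
  shows "g = 1"
proof (rule ccontr)
  assume "g \<noteq> 1"
  then obtain p where p: "Factorial_Ring.prime p" "p dvd g" using prime_factor_nat by blast
  have "g > 0" using g n by (intro Nat.gr0I) auto
  then have "p dvd fact (smarandache g)" using p(2) dvd_fact_smarandache dvd_trans by blast
  then have "p \<le> smarandache g" using p(1) by (simp add: prime_dvd_fact_iff)
  moreover have "least_prime_divisor n \<le> p"
    unfolding least_prime_divisor_def using p g by (intro Least_le) (auto intro: dvd_trans)
  ultimately show False using less by simp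
qed

lemma smarandache_in_beta_set:
  assumes n: "n \<ge> 2"
  shows "smarandache n \<in> beta_set n"
proof -
  have "gcd n (fact n) = n" using n by (simp add: gcd_proj1_iff dvd_fact)
  moreover have "least_prime_divisor n \<le> smarandache n"
  proof (rule ccontr)
    assume "\<not> least_prime_divisor n \<le> smarandache n"
    then show False using dvd_eq_1_if_smarandache_less[OF n, of n] n by simp
  qed
  ultimately show ?thesis unfolding beta_set_def by (auto intro!: exI[of _ n])
qed

lemma beta_in_beta_set: "n > 0 \<Longrightarrow> 1 \<le> j \<Longrightarrow> j \<le> num_betas n \<Longrightarrow> beta n j \<in> beta_set n"
  using set_beta[of n] by auto

lemma beta_antimono:
  assumes "1 \<le> i" "i \<le> j"
  shows "beta n j \<le> beta n i"
proof (cases "j \<le> num_betas n \<and> i \<noteq> j")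
  case True
  then show ?thesis using assms beta_strict_decreasing[of i j n] by simp
qed (use assms in \<open>auto simp: beta_def\<close>)

lemma beta_1:
  assumes n: "n \<ge> 2"
  shows "beta n 1 = smarandache n"
proof -
  obtain i where i: "i \<in> {1..num_betas n}" "smarandache n = beta n i"
    using smarandache_in_beta_set[OF n] set_beta[of n] n by (metis imageE less_le_trans zero_less_numeral)
  then have "smarandache n \<le> beta n 1" using beta_antimono[of 1 i n] by simp
  moreover have "beta n 1 \<in> beta_set n" using i n by (intro beta_in_beta_set) auto
  then have "beta n 1 \<le> smarandache n" using n by (auto simp: beta_set_def intro!: smarandache_mono)
  ultimately show ?thesis by simp
qed

text \<open>For \<open>g = gcd(n, k!)\<close> with \<open>k < \<beta>\<^sub>j\<close>, the number \<open>s(g) \<le> k\<close> is either below the least prime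
  divisor or some \<open>\<beta>\<^sub>i\<close> with \<open>i > j\<close>. In both cases \<open>s(g) \<le> \<beta>\<^sub>j\<^sub>+\<^sub>1\<close> unless \<open>j\<close> is the last index,
  so \<open>g\<close> already divides \<open>\<beta>\<^sub>j\<^sub>+\<^sub>1!\<close>. For the last index only the first case is possible, whence
  \<open>g = 1\<close>, in agreement with the convention that the order is then \<open>n\<close>.\<close>

lemma div_gcd_fact_eq_alpha:
  assumes n: "n \<ge> 2" and j: "1 \<le> j" "j \<le> num_betas n"
    and k: "beta n (j + 1) \<le> k" "k < beta n j"
  shows "n div gcd n (fact k) = alpha n (j + 1)"
proof -
  define g where "g = gcd n (fact k)"
  have g: "g > 0" "g dvd n" "g dvd fact k" using n by (auto simp: g_def)
  have sg: "smarandache g < beta n j" using smarandache_le[OF g(3)] k by simp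
  have later: "\<exists>i. j < i \<and> i \<le> num_betas n \<and> smarandache g = beta n i"
    if "least_prime_divisor n \<le> smarandache g"
  proof -
    have "smarandache g \<in> beta_set n" using that by (auto simp: beta_set_def g_def)
    then obtain i where i: "i \<in> {1..num_betas n}" "smarandache g = beta n i"
      using set_beta[of n] n by (metis imageE less_le_trans zero_less_numeral)
    then have "j < i" using beta_antimono[of i j n] sg by (cases "j < i") auto
    then show ?thesis using i by auto
  qed
  show ?thesis
  proof (cases "j = num_betas n")
    case True
    then have "g = 1" using later dvd_eq_1_if_smarandache_less[OF n g(2)] by fastforce
    then show ?thesis using True by (simp add: alpha_def g_def)
  next
    case False
    have "smarandache g \<le> beta n (j + 1)"
    proof (cases "least_prime_divisor n \<le> smarandache g")
      case True
      then show ?thesis using later beta_antimono[of "j + 1" _ n] by fastforce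
    next
      case less: False
      have "beta n (j + 1) \<in> beta_set n" using False j n by (intro beta_in_beta_set) auto
      then show ?thesis using less by (auto simp: beta_set_def)
    qed
    then have "g dvd fact (beta n (j + 1))"
      using dvd_fact_smarandache[OF g(1)] fact_dvd dvd_trans by blast
    then have "g = gcd n (fact (beta n (j + 1)))"
      using g k(1) unfolding g_def by (intro dvd_antisym) (auto intro: dvd_trans fact_dvd)
    then show ?thesis using False j by (simp add: alpha_def g_def)
  qed
qed

section \<open>The structure theorem\<close>

theorem theorem14:
  fixes n :: nat
  assumes "n \<ge> 2"
  shows "polyfunction_group (residue_ring (int n)) \<cong>
    sum_group {1..num_betas n}
      (\<lambda>j. direct_multiple (beta n j - beta n (j + 1)) (integer_mod_group (alpha n (j + 1))))"
proof -
  let ?t = "num_betas n"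
  let ?Z = "\<lambda>k. integer_mod_group (n div gcd n (fact k))"
  have "polyfunction_group (residue_ring (int n)) \<cong> sum_group {..<smarandache n} ?Z"
    using assms by (intro polyfunction_group_iso_factorial_sum dvd_fact_smarandache
        smarandache_le_self) auto
  also have "sum_group {..<smarandache n} ?Z \<cong> sum_group {1..?t}
      (\<lambda>j. sum_group {1..beta n j - beta n (j + 1)} (\<lambda>_. integer_mod_group (alpha n (j + 1))))"
  \<comment> \<open>The shift by one is due to the copies within a block being numbered from 1.\<close>
  proof (rule sum_group_regroup[where h = "\<lambda>j i. beta n (j + 1) + i - 1"])
    show "bij_betw (\<lambda>(j, i). beta n (j + 1) + i - 1)
        (SIGMA j:{1..?t}. {1..beta n j - beta n (j + 1)}) {..<smarandache n}"
      unfolding beta_1[OF assms, symmetric]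
      by (rule bij_betw_consecutive_blocks) (auto intro: beta_antimono simp: beta_def[of _ "Suc _"])
    show "integer_mod_group (alpha n (j + 1)) = ?Z (beta n (j + 1) + i - 1)"
      if "j \<in> {1..?t}" "i \<in> {1..beta n j - beta n (j + 1)}" for j i
    proof -
      have "n div gcd n (fact (beta n (j + 1) + i - 1)) = alpha n (j + 1)"
        using that by (intro div_gcd_fact_eq_alpha assms) auto
      then show ?thesis by simp
    qed
  qed simp
  finally show ?thesis unfolding direct_multiple_def .
qed

end
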